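(* Let $p:\mathbb{N}\to[0,1]$ and for $N\ge 1$ let $G(N,p(N))$ be the random graph on vertex set $\{0,1,\dots,N-1\}$ in which each pair of distinct vertices is joined by an edge independently with probability $p(N)$. Suppose that $p(N)$ satisfies one of the following conditions: (1) $p(N)\ll N^{-2}$; (2) for some integer $k$, $N^{-1-\frac1k}\ll p(N)\ll N^{-1-\frac{1}{k-1}}$; (3) $N^{-1-\epsilon}\ll p(N)\ll N^{-1}$ for all $\epsilon>0$; (4) $N^{-1}\ll p(N)\ll N^{-1}\log N$. Then the probability that the robber has a winning strategy in the cops and robber game with one cop and one robber played on $G(N,p(N))$ tends to $1$ as $N\to\infty$.
   Context: For functions $a,b$, $a(N)\ll b(N)$ means $\lim_{N\to\infty} a(N)/b(N)=0$. Cops and robber game on a finite simple graph $G$: graphs are treated as reflexive, i.e. a player may stay at its current vertex as a move. Cop and robber occupy vertices; the game is played with perfect information in a countable sequence of rounds, cop and robber moving alternately, each moving along an edge to an adjacent vertex or staying put. The cop wins if after some finite number of rounds she occupies the same vertex as the robber; the robber wins if he avoids the cop forever in an infinite play.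
   Formalization: Condition (2) as printed has its bounds in the wrong order and no p satisfies it; the formal version takes k ≥ 2 (so both exponents are defined) and also accepts the intended order N^{-1-1/(k-1)} ≪ p(N) ≪ N^{-1-1/k}. *)

theory Defs
  imports "HOL-Probability.Probability"
begin

text \<open>The quotient \<open>a N / b N\<close> must eventually make sense; without the first conjunct,
  \<open>x / 0 = 0\<close> would make every \<open>a\<close> negligible against \<open>b = 0\<close>.\<close>

definition negligible :: "(nat \<Rightarrow> real) \<Rightarrow> (nat \<Rightarrow> real) \<Rightarrow> bool" (infix "\<lless>" 50) where
  "a \<lless> b \<longleftrightarrow> (\<forall>\<^sub>F N in sequentially. b N \<noteq> 0) \<and> (\<lambda>N. a N / b N) \<longlonglongrightarrow> 0"

definition vertex_pairs :: "nat \<Rightarrow> nat set set" where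
  "vertex_pairs N = {e. e \<subseteq> {..<N} \<and> card e = 2}"

text \<open>A random graph is represented by its random edge set; its vertex set is \<open>{..<N}\<close>.\<close>

definition random_graph :: "nat \<Rightarrow> real \<Rightarrow> nat set set pmf" where
  "random_graph N q =
     map_pmf (\<lambda>f. {e \<in> vertex_pairs N. f e})
       (Pi_pmf (vertex_pairs N) False (\<lambda>_. bernoulli_pmf q))"

definition legal_move :: "'a set \<Rightarrow> 'a set set \<Rightarrow> 'a \<Rightarrow> 'a \<Rightarrow> bool" where
  "legal_move V E u v \<longleftrightarrow> u \<in> V \<and> v \<in> V \<and> (u = v \<or> {u, v} \<in> E)"

definition legal_walk :: "'a set \<Rightarrow> 'a set set \<Rightarrow> (nat \<Rightarrow> 'a) \<Rightarrow> bool" where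
  "legal_walk V E w \<longleftrightarrow> w 0 \<in> V \<and> (\<forall>n. legal_move V E (w n) (w (Suc n)))"

text \<open>In round 0 the cop and then the robber choose their initial vertices \<open>c 0\<close> and \<open>r 0\<close>;
  in round \<open>n + 1\<close> the cop moves from \<open>c n\<close> to \<open>c (n + 1)\<close>, then the robber from \<open>r n\<close> to
  \<open>r (n + 1)\<close>. The second disjunct is capture by a move of the cop, the first one is the
  robber placing himself on, or moving to, the vertex of the cop.\<close>

definition captured :: "(nat \<Rightarrow> 'a) \<Rightarrow> (nat \<Rightarrow> 'a) \<Rightarrow> bool" where
  "captured c r \<longleftrightarrow> (\<exists>n. r n = c n \<or> c (Suc n) = r n)"

text \<open>A strategy of the robber maps the history of the play, given as the positions
  \<open>c 0, \<dots>, c n\<close> of the cop and \<open>r 0, \<dots>, r (n - 1)\<close> of the robber, to his position \<open>r n\<close>.\<close>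

type_synonym 'a strategy = "'a list \<Rightarrow> 'a list \<Rightarrow> 'a"

fun robber_play :: "'a strategy \<Rightarrow> (nat \<Rightarrow> 'a) \<Rightarrow> nat \<Rightarrow> 'a" where
  "robber_play \<sigma> c n = \<sigma> (map c [0..<Suc n]) (map (\<lambda>i. robber_play \<sigma> c i) [0..<n])"

declare robber_play.simps [simp del]

definition robber_winning_strategy :: "'a set \<Rightarrow> 'a set set \<Rightarrow> 'a strategy \<Rightarrow> bool" where
  "robber_winning_strategy V E \<sigma> \<longleftrightarrow>
     (\<forall>c. legal_walk V E c \<longrightarrow>
        legal_walk V E (robber_play \<sigma> c) \<and> \<not> captured c (robber_play \<sigma> c))"

definition robber_wins :: "'a set \<Rightarrow> 'a set set \<Rightarrow> bool" where
  "robber_wins V E \<longleftrightarrow> (\<exists>\<sigma>. robber_winning_strategy V E \<sigma>)"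

end

theory Submission
  imports Defs "HOL-Real_Asymp.Real_Asymp"
begin

text \<open>
  Every one of the four ranges of \<open>p\<close> lies below \<open>ln N / N\<close>. There the expected number of
  isolated vertices, \<open>\<mu> = N (1 - p)\<^bsup>N - 1\<^esup>\<close>, tends to infinity, and the second moment
  method bounds the probability that there is none by \<open>1 / \<mu> + p / (1 - p)\<close>, which tends to 0.
  On a graph with an isolated vertex \<open>v\<close> and at least one further vertex the robber wins by
  staying put: at \<open>v\<close>, or anywhere else if the cop starts at \<open>v\<close>.
\<close>

section \<open>Pairs at a vertex and avoidance probabilities\<close>

definition incident_pairs :: "nat \<Rightarrow> nat \<Rightarrow> nat set set" where
  "incident_pairs N v = {e \<in> vertex_pairs N. v \<in> e}"

lemma finite_vertex_pairs [simp]: "finite (vertex_pairs N)"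
  by (rule finite_subset [of _ "Pow {..<N}"]) (auto simp: vertex_pairs_def)

lemma incident_pairs_subset: "incident_pairs N v \<subseteq> vertex_pairs N"
  by (auto simp: incident_pairs_def)

lemma finite_incident_pairs [simp]: "finite (incident_pairs N v)"
  by (rule finite_subset [OF incident_pairs_subset]) simp

lemma card_incident_pairs:
  assumes "v < N"
  shows "card (incident_pairs N v) = N - 1"
proof -
  have "incident_pairs N v = (\<lambda>u. {u, v}) ` ({..<N} - {v})"
    using assms by (auto simp: incident_pairs_def vertex_pairs_def card_2_iff doubleton_eq_iff)
  moreover have "inj_on (\<lambda>u. {u, v}) ({..<N} - {v})"
    by (auto simp: inj_on_def doubleton_eq_iff)
  ultimately show ?thesis
    using assms by (simp add: card_image)
qed

text \<open>Inclusion-exclusion: the two stars have \<open>N - 1\<close> pairs each and share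
  exactly the pair \<open>{u, v}\<close>.\<close>

lemma card_incident_pairs_Un:
  assumes "u < N" "v < N" "u \<noteq> v"
  shows "card (incident_pairs N u \<union> incident_pairs N v) = 2 * N - 3"
proof -
  have "incident_pairs N u \<inter> incident_pairs N v = {{u, v}}"
    using assms by (auto simp: incident_pairs_def vertex_pairs_def card_2_iff doubleton_eq_iff)
  then show ?thesis
    using card_Un_Int [of "incident_pairs N u" "incident_pairs N v"] assms
    by (simp add: card_incident_pairs)
qed

text \<open>In the product space of edge indicators the event is a box: coordinates in
  \<open>S\<close> are forced to \<open>False\<close>, each at cost \<open>1 - q\<close>, and all
  others are free.\<close>

lemma prob_random_graph_avoids:
  assumes "0 \<le> q" "q \<le> 1" "S \<subseteq> vertex_pairs N"
  shows "measure_pmf.prob (random_graph N q) {E. E \<inter> S = {}} = (1 - q) ^ card S"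
proof -
  let ?B = "\<lambda>e. if e \<in> S then {False} else UNIV"
  have "measure_pmf.prob (random_graph N q) {E. E \<inter> S = {}} =
        measure_pmf.prob (Pi_pmf (vertex_pairs N) False (\<lambda>_. bernoulli_pmf q))
          (Pi (vertex_pairs N) ?B)"
    unfolding random_graph_def measure_map_pmf
    by (rule arg_cong [where f = "measure_pmf.prob _"]) (use assms in \<open>auto simp: Pi_def\<close>)
  also have "\<dots> = (\<Prod>e\<in>vertex_pairs N. measure_pmf.prob (bernoulli_pmf q) (?B e))"
    by (rule measure_Pi_pmf_Pi) simp
  also have "\<dots> = (\<Prod>e\<in>vertex_pairs N. if e \<in> S then 1 - q else 1)"
    using assms by (intro prod.cong) (auto simp: measure_pmf_single)
  also have "\<dots> = (1 - q) ^ card S"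
    using assms(3) by (simp add: prod.If_cases Int_absorb1)
  finally show ?thesis .
qed

section \<open>Second moment bound for isolated vertices\<close>

text \<open>Chebyshev's inequality for the number \<open>X\<close> of events that occur: where none
  occurs, \<open>X = 0\<close> and hence \<open>(X - \<mu>)\<^sup>2 = \<mu>\<^sup>2\<close>, so
  \<open>\<mu>\<^sup>2\<close> times the probability of this is at most the variance of
  \<open>X\<close>. The double sum is the second moment of \<open>X\<close>.\<close>

lemma (in prob_space) second_moment_method:
  fixes A :: "'i \<Rightarrow> 'a set"
  assumes I: "finite I" and A: "\<And>i. i \<in> I \<Longrightarrow> A i \<in> events"
    and pos: "(\<Sum>i\<in>I. prob (A i)) > 0"
  shows "prob (space M - (\<Union>i\<in>I. A i)) \<le>
    (\<Sum>i\<in>I. \<Sum>j\<in>I. prob (A i \<inter> A j)) / (\<Sum>i\<in>I. prob (A i))\<^sup>2 - 1"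
proof -
  define \<mu> where "\<mu> = (\<Sum>i\<in>I. prob (A i))"
  define X :: "'a \<Rightarrow> real" where "X = (\<lambda>x. \<Sum>i\<in>I. indicator (A i) x)"
  let ?Z = "space M - (\<Union>i\<in>I. A i)"
  have Z: "?Z \<in> events"
    using I A by auto
  have X2: "(X x)\<^sup>2 = (\<Sum>i\<in>I. \<Sum>j\<in>I. indicator (A i \<inter> A j) x)" for x
    by (simp add: X_def power2_eq_square sum_product indicator_inter_arith)
  have int: "integrable M X" "integrable M (\<lambda>x. (X x)\<^sup>2)"
    unfolding X2 using A
    by (auto simp: X_def emeasure_eq_measure
        intro!: Bochner_Integration.integrable_sum integrable_real_indicator)
  have EX: "expectation X = \<mu>"
    using A sets.sets_into_space
    by (simp add: X_def \<mu>_def emeasure_eq_measure Int_absorb2 Int_commute)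
  have EX2: "expectation (\<lambda>x. (X x)\<^sup>2) = (\<Sum>i\<in>I. \<Sum>j\<in>I. prob (A i \<inter> A j))"
  proof -
    have "A i \<inter> A j \<inter> space M = A i \<inter> A j" if "i \<in> I" for i j
      using A [OF that] sets.sets_into_space by blast
    then show ?thesis
      unfolding X2 using A
      by (subst Bochner_Integration.integral_sum)
        (auto simp: emeasure_eq_measure
          intro!: Bochner_Integration.integrable_sum integrable_real_indicator)
  qed
  have "\<mu>\<^sup>2 * prob ?Z = expectation (\<lambda>x. \<mu>\<^sup>2 * indicator ?Z x)"
    using Z by (simp add: sets.Int_space_eq2)
  also have "\<dots> \<le> expectation (\<lambda>x. (X x)\<^sup>2 - 2 * \<mu> * X x + \<mu>\<^sup>2)"
  proof (rule integral_mono)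
    show "integrable M (\<lambda>x. \<mu>\<^sup>2 * indicator ?Z x)"
      using Z by (auto simp: emeasure_eq_measure)
    show "integrable M (\<lambda>x. (X x)\<^sup>2 - 2 * \<mu> * X x + \<mu>\<^sup>2)"
      using int by auto
    fix x
    \<comment> \<open>Equality holds on \<open>?Z\<close>, where \<open>X\<close> vanishes;
      elsewhere the left side is 0 and the right side is a square.\<close>
    have "(X x)\<^sup>2 - 2 * \<mu> * X x + \<mu>\<^sup>2 = (X x - \<mu>)\<^sup>2"
      by (simp add: power2_diff)
    moreover have "X x = 0" if "x \<in> ?Z"
      using that by (auto simp: X_def)
    ultimately show "\<mu>\<^sup>2 * indicator ?Z x \<le> (X x)\<^sup>2 - 2 * \<mu> * X x + \<mu>\<^sup>2"
      by (auto simp: indicator_def)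
  qed
  also have "\<dots> = (\<Sum>i\<in>I. \<Sum>j\<in>I. prob (A i \<inter> A j)) - \<mu>\<^sup>2"
    using int by (simp add: EX EX2 prob_space) (simp add: power2_eq_square)
  finally show ?thesis
    using pos by (simp add: \<mu>_def [symmetric] field_simps)
qed

text \<open>Isolation of two distinct vertices is almost independent: the shared pair is counted
  once instead of twice, so the joint probability exceeds the product by the factor
  \<open>1 / (1 - q)\<close> only. The diagonal of the double sum yields \<open>1 / \<mu>\<close>,
  and the excess factor yields \<open>1 / (1 - q) - 1 = q / (1 - q)\<close>.\<close>

lemma prob_no_isolated_vertex_le:
  assumes q: "0 \<le> q" "q < 1" and N: "N \<ge> 2"
  shows "measure_pmf.prob (random_graph N q) {E. \<forall>v<N. E \<inter> incident_pairs N v \<noteq> {}}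
    \<le> 1 / (real N * (1 - q) ^ (N - 1)) + q / (1 - q)"
proof -
  define A where "A = (\<lambda>v. {E. E \<inter> incident_pairs N v = {}})"
  define \<mu> where "\<mu> = real N * (1 - q) ^ (N - 1)"
  let ?P = "measure_pmf.prob (random_graph N q)"
  have \<mu>: "\<mu> > 0"
    using q N by (simp add: \<mu>_def)
  have single: "?P (A v) = (1 - q) ^ (N - 1)" if "v < N" for v
    unfolding A_def using q that
    by (subst prob_random_graph_avoids) (auto simp: incident_pairs_subset card_incident_pairs)
  have pair: "?P (A u \<inter> A v) = (1 - q) ^ (2 * N - 3)" if "u < N" "v < N" "u \<noteq> v" for u v
  proof -
    have "A u \<inter> A v = {E. E \<inter> (incident_pairs N u \<union> incident_pairs N v) = {}}"
      by (auto simp: A_def)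
    then show ?thesis
      using q that incident_pairs_subset
      by (simp only:) (subst prob_random_graph_avoids, auto simp: card_incident_pairs_Un)
  qed
  have first: "(\<Sum>v<N. ?P (A v)) = \<mu>"
    by (simp add: single \<mu>_def)
  have "(\<Sum>v<N. ?P (A u \<inter> A v)) = (1 - q) ^ (N - 1) + real (N - 1) * (1 - q) ^ (2 * N - 3)"
    if u: "u < N" for u
  proof -
    have "(\<Sum>v<N. ?P (A u \<inter> A v)) = ?P (A u \<inter> A u) + (\<Sum>v\<in>{..<N} - {u}. ?P (A u \<inter> A v))"
      using u by (subst sum.remove [of _ u]) auto
    then show ?thesis
      using u by (simp add: single pair)
  qed
  then have second: "(\<Sum>u<N. \<Sum>v<N. ?P (A u \<inter> A v)) =
      \<mu> + real N * real (N - 1) * (1 - q) ^ (2 * N - 3)"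
    using N by (simp add: \<mu>_def distrib_left of_nat_diff)
  \<comment> \<open>The extra factor \<open>1 - q\<close> restores the shared pair and turns the
    exponent into \<open>2 * (N - 1)\<close>, which makes the term comparable with
    \<open>\<mu>\<^sup>2\<close>.\<close>
  have "real N * real (N - 1) * (1 - q) ^ (2 * N - 3) * (1 - q)
      = real N * real (N - 1) * ((1 - q) ^ (N - 1))\<^sup>2"
  proof -
    have "Suc (2 * N - 3) = (N - 1) * 2"
      using N by simp
    then have "(1 - q) ^ (2 * N - 3) * (1 - q) = ((1 - q) ^ (N - 1))\<^sup>2"
      by (metis power_Suc2 power_mult)
    then show ?thesis
      by simp
  qed
  also have "\<dots> \<le> real N * real N * ((1 - q) ^ (N - 1))\<^sup>2"
    by (intro mult_right_mono mult_left_mono) auto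
  also have "\<dots> = \<mu>\<^sup>2"
    by (simp add: \<mu>_def power2_eq_square)
  finally have le: "real N * real (N - 1) * (1 - q) ^ (2 * N - 3) \<le> \<mu>\<^sup>2 / (1 - q)"
    using q by (simp add: field_simps)
  have "{E. \<forall>v<N. E \<inter> incident_pairs N v \<noteq> {}} = UNIV - (\<Union>v\<in>{..<N}. A v)"
    by (auto simp: A_def)
  then have "?P {E. \<forall>v<N. E \<inter> incident_pairs N v \<noteq> {}}
      \<le> (\<mu> + real N * real (N - 1) * (1 - q) ^ (2 * N - 3)) / \<mu>\<^sup>2 - 1"
    using measure_pmf.second_moment_method [of "{..<N}" A "random_graph N q"] \<mu>
    by (simp add: first second)
  also have "\<dots> \<le> (\<mu> + \<mu>\<^sup>2 / (1 - q)) / \<mu>\<^sup>2 - 1"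
    using le \<mu> by (intro diff_right_mono divide_right_mono) auto
  also have "\<dots> = 1 / \<mu> + q / (1 - q)"
    using \<mu> q by (simp add: field_simps power2_eq_square)
  finally show ?thesis
    by (simp add: \<mu>_def)
qed

section \<open>The game on a graph with an isolated vertex\<close>

lemma robber_wins_if_isolated:
  fixes V :: "'a set"
  assumes v: "v \<in> V" and w: "w \<in> V" "w \<noteq> v"
    and isolated: "\<And>u. u \<in> V \<Longrightarrow> u \<noteq> v \<Longrightarrow> {u, v} \<notin> E"
  shows "robber_wins V E"
proof -
  \<comment> \<open>The robber chooses after the cop, so \<open>cs\<close> is never empty and
    \<open>hd cs\<close> is the cop's initial vertex; the resulting play is constant.\<close>
  define \<sigma> :: "'a strategy" where "\<sigma> = (\<lambda>cs rs. if hd cs = v then w else v)"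
  have play: "robber_play \<sigma> c n = (if c 0 = v then w else v)" for c n
    by (subst robber_play.simps) (simp add: \<sigma>_def hd_map del: upt_Suc)
  have "robber_winning_strategy V E \<sigma>"
    unfolding robber_winning_strategy_def
  proof (intro allI impI)
    fix c assume c: "legal_walk V E c"
    \<comment> \<open>Invariant: the cop can neither enter nor leave \<open>v\<close>. Either form
      of capture would put her on the robber's vertex, across this divide.\<close>
    have "(c n = v) = (c 0 = v)" for n
    proof (induction n)
      case (Suc n)
      have "legal_move V E (c n) (c (Suc n))"
        using c by (simp add: legal_walk_def)
      then have "(c (Suc n) = v) = (c n = v)"
        using isolated by (metis insert_commute legal_move_def)
      then show ?case
        using Suc by simp
    qed simp
    then have "\<not> captured c (robber_play \<sigma> c)"
      using w by (auto simp: captured_def play)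
    moreover have "legal_walk V E (robber_play \<sigma> c)"
      using v w by (simp add: legal_walk_def legal_move_def play)
    ultimately show "legal_walk V E (robber_play \<sigma> c) \<and> \<not> captured c (robber_play \<sigma> c)"
      by blast
  qed
  then show ?thesis
    by (auto simp: robber_wins_def)
qed

lemma robber_wins_if_no_incident_pair:
  assumes "N \<ge> 2" "v < N" "E \<inter> incident_pairs N v = {}"
  shows "robber_wins {..<N} E"
proof (rule robber_wins_if_isolated)
  \<comment> \<open>A second vertex as refuge from a cop who starts at \<open>v\<close>; both 0 and
    1 are available since \<open>N \<ge> 2\<close>.\<close>
  show "(if v = 0 then 1 else 0) \<in> {..<N}" "(if v = 0 then 1 else 0) \<noteq> v"
    using assms by auto
  show "{u, v} \<notin> E" if "u \<in> {..<N}" "u \<noteq> v" for u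
    using that assms by (auto simp: incident_pairs_def vertex_pairs_def)
qed (use assms in auto)

lemma prob_robber_wins_ge:
  assumes "0 \<le> q" "q < 1" "N \<ge> 2"
  shows "measure_pmf.prob (random_graph N q) {E. robber_wins {..<N} E}
    \<ge> 1 - (1 / (real N * (1 - q) ^ (N - 1)) + q / (1 - q))"
proof -
  let ?P = "measure_pmf.prob (random_graph N q)"
  have "1 - ?P {E. robber_wins {..<N} E} = ?P (UNIV - {E. robber_wins {..<N} E})"
    using measure_pmf.prob_compl [of "{E. robber_wins {..<N} E}" "random_graph N q"] by simp
  also have "\<dots> \<le> ?P {E. \<forall>v<N. E \<inter> incident_pairs N v \<noteq> {}}"
    using assms robber_wins_if_no_incident_pair by (intro measure_pmf.finite_measure_mono) auto
  finally show ?thesis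
    using prob_no_isolated_vertex_le [OF assms] by linarith
qed

section \<open>Asymptotics\<close>

text \<open>For \<open>q \<le> 1 / 2\<close>,
  \<open>1 / (1 - q) \<le> 1 + 2 * q \<le> exp (2 * q)\<close>; invert and take powers.\<close>

lemma one_minus_power_ge_exp:
  fixes q :: real
  assumes "0 \<le> q" "q \<le> 1 / 2"
  shows "(1 - q) ^ n \<ge> exp (- 2 * q * real n)"
proof -
  have "1 / (1 - q) = 1 + q / (1 - q)"
    using assms by (simp add: field_simps)
  also have "q / (1 - q) \<le> 2 * q"
    using assms mult_left_mono [of "2 * q" 1 q] by (simp add: field_simps)
  also have "1 + 2 * q \<le> exp (2 * q)"
    by (rule exp_ge_add_one_self)
  finally have "1 \<le> exp (2 * q) * (1 - q)"
    using assms by (simp add: field_simps)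
  then have "exp (- 2 * q) \<le> 1 - q"
    by (simp add: exp_minus field_simps)
  then have "exp (- 2 * q) ^ n \<le> (1 - q) ^ n"
    by (intro power_mono) auto
  then show ?thesis
    by (simp add: exp_of_nat_mult [symmetric] mult_ac)
qed

lemma negligible_mono:
  assumes "a \<lless> b" "\<forall>\<^sub>F N in sequentially. 0 < b N \<and> b N \<le> c N"
  shows "a \<lless> c"
proof -
  have lim: "(\<lambda>N. a N / b N) \<longlonglongrightarrow> 0"
    using assms(1) by (simp add: negligible_def)
  have "(\<lambda>N. a N / c N) \<longlonglongrightarrow> 0"
  proof (rule Lim_null_comparison [OF _ tendsto_norm_zero [OF lim]])
    show "\<forall>\<^sub>F N in sequentially. norm (a N / c N) \<le> norm (a N / b N)"
      using assms(2) by eventually_elim (auto simp: abs_divide intro!: divide_left_mono)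
  qed
  moreover have "\<forall>\<^sub>F N in sequentially. c N \<noteq> 0"
    using assms(2) by eventually_elim auto
  ultimately show ?thesis
    by (simp add: negligible_def)
qed

text \<open>Reduces the polynomial upper bounds to the logarithmic one: the two are comparable as
  soon as \<open>ln (real N) \<ge> 1\<close>.\<close>

lemma negligible_powr_imp_negligible_log:
  assumes "p \<lless> (\<lambda>N. real N powr a)" "a \<le> -1"
  shows "p \<lless> (\<lambda>N. real N powr (-1) * ln (real N))"
proof (rule negligible_mono [OF assms(1)])
  have "\<forall>\<^sub>F N in sequentially. ln (real N) \<ge> 1" "\<forall>\<^sub>F N in sequentially. real N \<ge> 1"
    by real_asymp+
  then show "\<forall>\<^sub>F N in sequentially.
      0 < real N powr a \<and> real N powr a \<le> real N powr (-1) * ln (real N)"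
  proof eventually_elim
    case (elim N)
    have "real N powr a \<le> real N powr (-1) * 1"
      using elim assms(2) powr_mono [of a "-1" "real N"] by simp
    also have "\<dots> \<le> real N powr (-1) * ln (real N)"
      using elim by (intro mult_left_mono) auto
    finally show ?case
      using elim by simp
  qed
qed

lemma prob_robber_wins_tendsto_1:
  assumes p01: "\<And>N. 0 \<le> p N \<and> p N \<le> 1"
    and p: "p \<lless> (\<lambda>N. real N powr (-1) * ln (real N))"
  shows "(\<lambda>N. measure_pmf.prob (random_graph N (p N)) {E. robber_wins {..<N} E}) \<longlonglongrightarrow> 1"
proof -
  \<comment> \<open>A bound \<open>p N < c * ln N / N\<close> gives
    \<open>\<mu> \<ge> N powr (1 - 2 * c)\<close>, which diverges for \<open>c < 1 / 2\<close>; with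
    \<open>c = 1 / 4\<close> it is the square root of \<open>N\<close>.\<close>
  have "\<forall>\<^sub>F N in sequentially. p N / (real N powr (-1) * ln (real N)) < 1 / 4"
    using p by (intro order_tendstoD) (auto simp: negligible_def)
  moreover have "\<forall>\<^sub>F N in sequentially. ln (real N) / real N \<le> 1 / 2"
    "\<forall>\<^sub>F N in sequentially. N \<ge> 2"
    by (real_asymp, rule eventually_ge_at_top)
  ultimately have lower: "\<forall>\<^sub>F N in sequentially.
      1 - (real N powr (-1/2) + ln (real N) / real N)
      \<le> measure_pmf.prob (random_graph N (p N)) {E. robber_wins {..<N} E}"
  proof eventually_elim
    case (elim N)
    have ln: "ln (real N) > 0"
      using elim by simp
    have pN: "p N * real N \<le> ln (real N) / 4"
      using elim ln by (simp add: powr_minus field_simps)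
    then have p_le: "4 * p N \<le> ln (real N) / real N"
      using elim by (simp add: field_simps)
    then have half: "p N \<le> 1 / 2"
      using elim by linarith
    have "exp (- ln (real N) / 2) \<le> exp (- 2 * p N * real (N - 1))"
    proof -
      have "p N * real (N - 1) \<le> p N * real N"
        using p01 by (intro mult_left_mono) auto
      then show ?thesis
        using pN by simp
    qed
    also have "\<dots> \<le> (1 - p N) ^ (N - 1)"
      using p01 half by (intro one_minus_power_ge_exp) auto
    finally have "real N * exp (- ln (real N) / 2) \<le> real N * (1 - p N) ^ (N - 1)"
      by (intro mult_left_mono) auto
    moreover have "real N * exp (- ln (real N) / 2) = real N powr (1/2)"
    proof -
      have "real N * exp (- ln (real N) / 2) = exp (ln (real N)) * exp (- ln (real N) / 2)"
        using elim by simp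
      also have "\<dots> = exp (ln (real N) / 2)"
        by (simp only: exp_add [symmetric]) simp
      finally show ?thesis
        using elim by (simp add: powr_def)
    qed
    ultimately have "real N powr (1/2) \<le> real N * (1 - p N) ^ (N - 1)"
      by (simp only:)
    then have "1 / (real N * (1 - p N) ^ (N - 1)) \<le> 1 / real N powr (1/2)"
      using elim half by (intro divide_left_mono mult_pos_pos) auto
    also have "\<dots> = real N powr (-1/2)"
      by (simp add: powr_minus_divide)
    finally have 1: "1 / (real N * (1 - p N) ^ (N - 1)) \<le> real N powr (-1/2)" .
    \<comment> \<open>The correlation term of the second moment bound; it tends to 0 together with
      \<open>p\<close>.\<close>
    have "p N / (1 - p N) \<le> 2 * p N"
      using p01 [of N] half mult_left_mono [of "2 * p N" 1 "p N"] by (simp add: field_simps)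
    also have "\<dots> \<le> ln (real N) / real N"
      using p_le p01 [of N] by linarith
    finally have 2: "p N / (1 - p N) \<le> ln (real N) / real N" .
    show ?case
      using prob_robber_wins_ge [of "p N" N] p01 [of N] half elim 1 2 by linarith
  qed
  have "(\<lambda>N. 1 - (real N powr (-1/2) + ln (real N) / real N)) \<longlonglongrightarrow> 1"
    by real_asymp
  then show ?thesis
    \<comment> \<open>The upper comparison sequence is the constant 1, as the values are
      probabilities.\<close>
    by (rule tendsto_sandwich [OF lower always_eventually _ tendsto_const, rotated]) simp
qed

theorem theorem9:
  fixes p :: "nat \<Rightarrow> real"
  assumes p01: "\<And>N. 0 \<le> p N \<and> p N \<le> 1"
    and p_range:
      "p \<lless> (\<lambda>N. real N powr (-2))
       \<or> (\<exists>k::int. k \<ge> 2 \<and>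
            ((\<lambda>N. real N powr (-1 - 1 / real_of_int k)) \<lless> p
               \<and> p \<lless> (\<lambda>N. real N powr (-1 - 1 / (real_of_int k - 1)))
             \<or> (\<lambda>N. real N powr (-1 - 1 / (real_of_int k - 1))) \<lless> p
               \<and> p \<lless> (\<lambda>N. real N powr (-1 - 1 / real_of_int k))))
       \<or> ((\<forall>\<epsilon>>0. (\<lambda>N. real N powr (-1 - \<epsilon>)) \<lless> p) \<and> p \<lless> (\<lambda>N. real N powr (-1)))
       \<or> ((\<lambda>N. real N powr (-1)) \<lless> p \<and> p \<lless> (\<lambda>N. real N powr (-1) * ln (real N)))"
  shows "(\<lambda>N. measure_pmf.prob (random_graph N (p N)) {E. robber_wins {..<N} E}) \<longlonglongrightarrow> 1"
proof (rule prob_robber_wins_tendsto_1 [OF p01])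
  show "p \<lless> (\<lambda>N. real N powr (-1) * ln (real N))"
    using p_range
  \<comment> \<open>Every case provides the logarithmic bound itself or a bound
    \<open>N powr a\<close> with \<open>a \<le> -1\<close>; in the cases with \<open>k\<close> the
    latter holds because \<open>k \<ge> 2\<close> makes \<open>k\<close> and \<open>k - 1\<close>
    positive.\<close>
  proof (elim disjE exE conjE)
    fix k :: int
    assume "k \<ge> 2" "p \<lless> (\<lambda>N. real N powr (-1 - 1 / (real_of_int k - 1)))"
    then show ?thesis
      by (elim negligible_powr_imp_negligible_log) simp
  next
    fix k :: int
    assume "k \<ge> 2" "p \<lless> (\<lambda>N. real N powr (-1 - 1 / real_of_int k))"
    then show ?thesis
      by (elim negligible_powr_imp_negligible_log) simp
  qed (assumption | erule negligible_powr_imp_negligible_log, simp)+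
qed

end
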